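(* Let $F\colon\mathbb Z_p^{n}\to\mathbb Z_p^{n}$ be uniformly differentiable modulo $p$ on $\mathbb Z_p^n$, with integer-valued partial derivatives modulo $p$, and asymptotically ergodic. Then $n=1$.
   Context: $\mathbb Z_p$, $\mathbb Q_p$, $\|\cdot\|_p$ are the $p$-adic integers, numbers and norm; for vectors $\|(u_1,\dots,u_n)\|_p=\max_i\|u_i\|_p$, and $\mathbf a\equiv\mathbf b\pmod{p^s}$ means $\|\mathbf a-\mathbf b\|_p\le p^{-s}$. $F$ is uniformly differentiable modulo $p$ on $\mathbb Z_p^n$ if there exist $N\in\mathbb N$ and for every $\mathbf u$ an $n\times n$ matrix $F'_1(\mathbf u)$ over $\mathbb Q_p$ such that for every integer $K\ge N$, every $\mathbf u\in\mathbb Z_p^n$ and every row vector $\mathbf h\in\mathbb Z_p^n$ with $\|\mathbf h\|_p\le p^{-K}$: $F(\mathbf u+\mathbf h)\equiv F(\mathbf u)+\mathbf hF'_1(\mathbf u)\pmod{p^{1+K}}$; its partial derivatives modulo $p$ are integer-valued if $F'_1(\mathbf u)$ can be chosen with entries in $\mathbb Z_p$ for all $\mathbf u$. $F$ is asymptotically ergodic if for all sufficiently large $k$ the map $\{0,\dots,p^k-1\}^n\to(\mathbb Z/p^k)^n$, $\mathbf x\mapsto F(\mathbf x)\bmod p^k$ (identifying $\{0,\dots,p^k-1\}^n$ with $(\mathbb Z/p^k)^n$) is a permutation consisting of a single cycle. *)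

theory Defs
  imports
    "HOL-Analysis.Finite_Cartesian_Product"
    "HOL-Analysis.Cartesian_Space"
    "HOL-Computational_Algebra.Fraction_Field"
    "HOL-Computational_Algebra.Polynomial_Factorial"
    "HOL-Combinatorics.Orbits"
    "Berlekamp_Zassenhaus.Finite_Field"
begin

section \<open>The $p$-adic integers\<close>

text \<open>
  The prime $p$ is the cardinality of a type of class \<open>prime_card\<close>. The $p$-adic integers are the
  inverse limit of the rings $\mathbb{Z}/p^k$, the latter being represented by $\{0,\dots,p^k-1\}$.
\<close>

typedef (overloaded) 'p::prime_card padic_int =
  "{x :: nat \<Rightarrow> int. \<forall>k. x k \<in> {0..<int CARD('p) ^ k} \<and> x (Suc k) mod int CARD('p) ^ k = x k}"
  morphisms padic_residue Abs_padic_int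
proof -
  have "0 < int CARD('p)" using prime_card_int[where 'a='p] prime_gt_0_int by blast
  then show ?thesis by (intro exI[of _ "\<lambda>_. 0"]) auto
qed

setup_lifting type_definition_padic_int

lemma card_gt_0: "0 < int CARD('p::prime_card)"
  using prime_card_int[where 'a='p] prime_gt_0_int by blast

lemma mod_power_Suc_mod_power: "(a::int) mod q ^ Suc k mod q ^ k = a mod q ^ k"
  by (simp add: mod_mod_cancel)

instantiation padic_int :: (prime_card) comm_ring_1
begin

lift_definition zero_padic_int :: "'a padic_int" is "\<lambda>_. 0"
  by (simp add: card_gt_0)

lift_definition one_padic_int :: "'a padic_int" is "\<lambda>k. 1 mod int CARD('a) ^ k"
  using card_gt_0[where 'p='a] by (auto simp: mod_power_Suc_mod_power simp del: power_Suc)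

lift_definition plus_padic_int :: "'a padic_int \<Rightarrow> 'a padic_int \<Rightarrow> 'a padic_int"
  is "\<lambda>x y k. (x k + y k) mod int CARD('a) ^ k"
  using card_gt_0[where 'p='a]
  by (auto simp: mod_power_Suc_mod_power simp del: power_Suc) (metis mod_add_eq)

lift_definition uminus_padic_int :: "'a padic_int \<Rightarrow> 'a padic_int"
  is "\<lambda>x k. (- x k) mod int CARD('a) ^ k"
  using card_gt_0[where 'p='a]
  by (auto simp: mod_power_Suc_mod_power simp del: power_Suc) (metis mod_minus_eq)

lift_definition minus_padic_int :: "'a padic_int \<Rightarrow> 'a padic_int \<Rightarrow> 'a padic_int"
  is "\<lambda>x y k. (x k - y k) mod int CARD('a) ^ k"
  using card_gt_0[where 'p='a]
  by (auto simp: mod_power_Suc_mod_power simp del: power_Suc) (metis mod_diff_eq)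

lift_definition times_padic_int :: "'a padic_int \<Rightarrow> 'a padic_int \<Rightarrow> 'a padic_int"
  is "\<lambda>x y k. (x k * y k) mod int CARD('a) ^ k"
  using card_gt_0[where 'p='a]
  by (auto simp: mod_power_Suc_mod_power simp del: power_Suc) (metis mod_mult_eq)

instance
proof
  fix a b c :: "'a padic_int"
  show "a * b * c = a * (b * c)"
    by transfer (auto simp: mod_simps algebra_simps)
  show "a * b = b * a"
    by transfer (auto simp: algebra_simps)
  show "1 * a = a"
    by transfer (auto simp: mod_simps)
  show "a + b + c = a + (b + c)"
    by transfer (auto simp: mod_simps algebra_simps)
  show "a + b = b + a"
    by transfer (auto simp: algebra_simps)
  show "0 + a = a"
    by transfer auto
  show "- a + a = 0"
    by transfer (auto simp: mod_simps)
  show "a - b = a + - b"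
    by transfer (auto simp: mod_simps)
  show "(a + b) * c = a * c + b * c"
    by transfer (auto simp: mod_simps algebra_simps)
  show "(0::'a padic_int) \<noteq> 1"
  proof transfer
    have "1 < int CARD('a)" using prime_card_int[where 'a='a] prime_gt_1_int by blast
    then have "(\<lambda>_. 0) (1::nat) \<noteq> (\<lambda>k. 1 mod int CARD('a) ^ k) (1::nat)" by simp
    then show "(\<lambda>_. 0) \<noteq> (\<lambda>k. 1 mod int CARD('a) ^ k)" by metis
  qed
qed

end

lemma padic_residue_mod:
  fixes x :: "'p::prime_card padic_int"
  assumes "k \<le> m"
  shows "padic_residue x m mod int CARD('p) ^ k = padic_residue x k"
  using assms
proof (induction m rule: dec_induct)
  case base
  show ?case using padic_residue[of x] by auto
next
  case (step m)
  have "padic_residue x (Suc m) mod int CARD('p) ^ k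
      = padic_residue x (Suc m) mod int CARD('p) ^ m mod int CARD('p) ^ k"
    using step.hyps by (simp add: mod_mod_cancel le_imp_power_dvd)
  then show ?case using step.IH padic_residue[of x] by auto
qed

lemma padic_residue_of_int:
  "padic_residue (of_int a :: 'p::prime_card padic_int) k = a mod int CARD('p) ^ k"
proof -
  have nat: "padic_residue (of_nat n :: 'p padic_int) k = int n mod int CARD('p) ^ k" for n
    by (induction n)
      (auto simp: zero_padic_int.rep_eq one_padic_int.rep_eq plus_padic_int.rep_eq mod_simps)
  show ?thesis
    by (cases a rule: int_cases2) (auto simp: nat uminus_padic_int.rep_eq mod_simps)
qed

definition padic_ord :: "'p::prime_card padic_int \<Rightarrow> nat" where
  "padic_ord x = Max {k. padic_residue x k = 0}"

definition padic_int_norm :: "'p::prime_card padic_int \<Rightarrow> real" where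
  "padic_int_norm x = (if x = 0 then 0 else real CARD('p) powi (- int (padic_ord x)))"

lemma padic_residue_eq_0_iff:
  fixes x :: "'p::prime_card padic_int"
  assumes "x \<noteq> 0"
  shows "padic_residue x k = 0 \<longleftrightarrow> k \<le> padic_ord x"
proof -
  let ?S = "{k. padic_residue x k = 0}"
  obtain m where m: "padic_residue x m \<noteq> 0"
    using assms by (metis ext padic_residue_inject zero_padic_int.rep_eq)
  have down: "padic_residue x j = 0" if "j \<le> i" "padic_residue x i = 0" for i j
    using padic_residue_mod[OF that(1), of x] that(2) by simp
  have fin: "finite ?S"
    by (rule finite_subset[of _ "{..m}"]) (use m down nat_le_linear in \<open>blast, simp\<close>)
  have "padic_residue x 0 = 0" using padic_residue_mod[of 0 0 x] by simp
  then have "?S \<noteq> {}" by blast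
  with fin have "padic_ord x \<in> ?S" unfolding padic_ord_def by (rule Max_in)
  then show ?thesis using down fin unfolding padic_ord_def by auto
qed

lemma padic_ord_dvd_iff:
  fixes x :: "'p::prime_card padic_int"
  assumes "x \<noteq> 0" "k \<le> m"
  shows "int CARD('p) ^ k dvd padic_residue x m \<longleftrightarrow> k \<le> padic_ord x"
  using padic_residue_mod[OF assms(2), of x] padic_residue_eq_0_iff[OF assms(1), of k]
  by (simp add: dvd_eq_mod_eq_0)

lemma padic_ord_mult_aux:
  fixes x y :: "'p::prime_card padic_int"
  assumes x: "x \<noteq> 0" and y: "y \<noteq> 0"
  shows "padic_residue (x * y) k = 0 \<longleftrightarrow> k \<le> padic_ord x + padic_ord y"
proof -
  let ?p = "int CARD('p)"
  define m where "m = k + padic_ord x + padic_ord y + 1"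
  have p: "prime ?p" by (rule prime_card_int)
  obtain a where a: "padic_residue x m = ?p ^ padic_ord x * a"
    using padic_ord_dvd_iff[OF x, of "padic_ord x" m] by (auto simp: m_def)
  obtain b where b: "padic_residue y m = ?p ^ padic_ord y * b"
    using padic_ord_dvd_iff[OF y, of "padic_ord y" m] by (auto simp: m_def)
  have na: "\<not> ?p dvd a"
  proof
    assume "?p dvd a"
    then have "?p ^ Suc (padic_ord x) dvd padic_residue x m"
      unfolding a power_Suc2 by (rule mult_dvd_mono[OF dvd_refl])
    then show False using padic_ord_dvd_iff[OF x, of "Suc (padic_ord x)" m]
      by (simp add: m_def)
  qed
  have nb: "\<not> ?p dvd b"
  proof
    assume "?p dvd b"
    then have "?p ^ Suc (padic_ord y) dvd padic_residue y m"
      unfolding b power_Suc2 by (rule mult_dvd_mono[OF dvd_refl])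
    then show False using padic_ord_dvd_iff[OF y, of "Suc (padic_ord y)" m]
      by (simp add: m_def)
  qed
  have nab: "\<not> ?p dvd a * b" using na nb p by (simp add: prime_dvd_mult_iff)
  have "padic_residue (x * y) k = padic_residue (x * y) m mod ?p ^ k"
    using padic_residue_mod[of k m "x * y"] by (simp add: m_def)
  also have "\<dots> = padic_residue x m * padic_residue y m mod ?p ^ k"
    unfolding times_padic_int.rep_eq
    by (rule mod_mod_cancel) (simp add: m_def le_imp_power_dvd)
  finally have "padic_residue (x * y) k = 0 \<longleftrightarrow> ?p ^ k dvd ?p ^ (padic_ord x + padic_ord y) * (a * b)"
    by (simp add: a b dvd_eq_mod_eq_0 power_add ac_simps)
  also have "\<dots> \<longleftrightarrow> k \<le> padic_ord x + padic_ord y"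
  proof
    assume *: "?p ^ k dvd ?p ^ (padic_ord x + padic_ord y) * (a * b)"
    show "k \<le> padic_ord x + padic_ord y"
    proof (rule ccontr)
      assume "\<not> ?thesis"
      then have "?p ^ Suc (padic_ord x + padic_ord y) dvd ?p ^ k"
        by (intro le_imp_power_dvd) simp
      with * have "?p ^ (padic_ord x + padic_ord y) * ?p dvd ?p ^ (padic_ord x + padic_ord y) * (a * b)"
        by (metis dvd_trans power_Suc2)
      then show False using nab p by simp
    qed
  qed (simp add: le_imp_power_dvd)
  finally show ?thesis .
qed

instance padic_int :: (prime_card) idom
proof
  fix x y :: "'a padic_int"
  assume "x \<noteq> 0" "y \<noteq> 0"
  then have "padic_residue (x * y) (Suc (padic_ord x + padic_ord y)) \<noteq> 0"
    by (simp add: padic_ord_mult_aux)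
  then show "x * y \<noteq> 0" by (metis zero_padic_int.rep_eq)
qed

lemma padic_ord_mult:
  fixes x y :: "'p::prime_card padic_int"
  assumes "x \<noteq> 0" "y \<noteq> 0"
  shows "padic_ord (x * y) = padic_ord x + padic_ord y"
  using padic_residue_eq_0_iff[of "x * y"] padic_ord_mult_aux[OF assms] assms
  by (meson le_antisym le_refl mult_eq_0_iff)

lemma padic_int_norm_mult:
  "padic_int_norm (x * y) = padic_int_norm x * padic_int_norm (y :: 'p::prime_card padic_int)"
  using card_gt_0[where 'p='p]
  by (auto simp: padic_int_norm_def padic_ord_mult power_int_add[symmetric])

lemma padic_int_norm_eq_0_iff: "padic_int_norm (x :: 'p::prime_card padic_int) = 0 \<longleftrightarrow> x = 0"
  using card_gt_0[where 'p='p] by (auto simp: padic_int_norm_def)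

lemma padic_int_norm_le_iff:
  fixes x :: "'p::prime_card padic_int"
  shows "padic_int_norm x \<le> real CARD('p) powi (- int k) \<longleftrightarrow> padic_residue x k = 0"
proof (cases "x = 0")
  case True
  then show ?thesis by (simp add: padic_int_norm_def zero_padic_int.rep_eq)
next
  case False
  have "1 < CARD('p)" using prime_card[where 'a='p] prime_gt_1_nat by blast
  then show ?thesis using False
    by (simp add: padic_int_norm_def padic_residue_eq_0_iff power_int_minus)
qed

section \<open>The $p$-adic numbers\<close>

type_synonym 'p padic = "'p padic_int fract"

definition padic_norm :: "'p::prime_card padic \<Rightarrow> real" where
  "padic_norm q =
     (THE r. \<exists>a b. b \<noteq> 0 \<and> q = Fract a b \<and> r = padic_int_norm a / padic_int_norm b)"

lemma padic_norm_Fract: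
  fixes a b :: "'p::prime_card padic_int"
  assumes b: "b \<noteq> 0"
  shows "padic_norm (Fract a b) = padic_int_norm a / padic_int_norm b"
  unfolding padic_norm_def
proof (rule the_equality)
  show "\<exists>a' b'. b' \<noteq> 0 \<and> Fract a b = Fract a' b' \<and>
      padic_int_norm a / padic_int_norm b = padic_int_norm a' / padic_int_norm b'"
    using b by blast
next
  fix r
  assume "\<exists>a' b'. b' \<noteq> 0 \<and> Fract a b = Fract a' b' \<and> r = padic_int_norm a' / padic_int_norm b'"
  then obtain a' b' where b': "b' \<noteq> 0" and eq: "Fract a b = Fract a' b'"
    and r: "r = padic_int_norm a' / padic_int_norm b'" by blast
  from eq have "a * b' = a' * b" using b b' by (simp add: eq_fract)
  then have "padic_int_norm a * padic_int_norm b' = padic_int_norm a' * padic_int_norm b"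
    by (metis padic_int_norm_mult)
  then show "r = padic_int_norm a / padic_int_norm b"
    using b b' r by (simp add: padic_int_norm_eq_0_iff frac_eq_eq)
qed

lemma padic_norm_to_fract: "padic_norm (to_fract x) = padic_int_norm (x :: 'p::prime_card padic_int)"
proof -
  have "padic_int_norm (1 :: 'p padic_int) = 1"
    using padic_int_norm_mult[of "1::'p padic_int" 1]
      padic_int_norm_eq_0_iff[of "1::'p padic_int"] by simp
  then show ?thesis by (simp add: to_fract_def padic_norm_Fract)
qed

definition padic_vnorm :: "'p::prime_card padic ^ 'n \<Rightarrow> real" where
  "padic_vnorm u = Max (range (\<lambda>i. padic_norm (u $ i)))"

definition padic_cong :: "nat \<Rightarrow> 'p::prime_card padic ^ 'n \<Rightarrow> 'p padic ^ 'n \<Rightarrow> bool" where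
  "padic_cong s a b \<longleftrightarrow> padic_vnorm (a - b) \<le> real CARD('p) powi (- int s)"

definition to_padic_vec :: "'p::prime_card padic_int ^ 'n \<Rightarrow> 'p padic ^ 'n" where
  "to_padic_vec u = (\<chi> i. to_fract (u $ i))"

section \<open>Differentiability modulo $p$ and asymptotic ergodicity\<close>

definition is_derivative_mod_p ::
  "('p::prime_card padic_int ^ 'n \<Rightarrow> 'p padic_int ^ 'n) \<Rightarrow>
   ('p padic_int ^ 'n \<Rightarrow> 'p padic ^ 'n ^ 'n) \<Rightarrow> bool" where
  "is_derivative_mod_p F F' \<longleftrightarrow>
     (\<exists>N. \<forall>K\<ge>N. \<forall>u h. padic_vnorm (to_padic_vec h) \<le> real CARD('p) powi (- int K) \<longrightarrow>
        padic_cong (1 + K) (to_padic_vec (F (u + h)))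
          (to_padic_vec (F u) + to_padic_vec h v* F' u))"

definition uniformly_differentiable_mod_p ::
  "('p::prime_card padic_int ^ 'n \<Rightarrow> 'p padic_int ^ 'n) \<Rightarrow> bool" where
  "uniformly_differentiable_mod_p F \<longleftrightarrow> (\<exists>F'. is_derivative_mod_p F F')"

definition integer_valued_derivatives_mod_p ::
  "('p::prime_card padic_int ^ 'n \<Rightarrow> 'p padic_int ^ 'n) \<Rightarrow> bool" where
  "integer_valued_derivatives_mod_p F \<longleftrightarrow>
     (\<exists>F'. is_derivative_mod_p F F' \<and> (\<forall>u i j. F' u $ i $ j \<in> range to_fract))"

definition residue_vectors :: "'p::prime_card itself \<Rightarrow> nat \<Rightarrow> (int ^ 'n) set" where
  "residue_vectors _ k = {x. \<forall>i. x $ i \<in> {0..<int CARD('p) ^ k}}"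

definition reduced_map ::
  "('p::prime_card padic_int ^ 'n \<Rightarrow> 'p padic_int ^ 'n) \<Rightarrow> nat \<Rightarrow> int ^ 'n \<Rightarrow> int ^ 'n" where
  "reduced_map F k x = (\<chi> i. padic_residue (F (\<chi> j. of_int (x $ j)) $ i) k)"

definition asymptotically_ergodic ::
  "('p::prime_card padic_int ^ 'n \<Rightarrow> 'p padic_int ^ 'n) \<Rightarrow> bool" where
  "asymptotically_ergodic F \<longleftrightarrow>
     (\<forall>\<^sub>F k in sequentially.
        bij_betw (reduced_map F k) (residue_vectors TYPE('p) k) (residue_vectors TYPE('p) k) \<and>
        cyclic_on (reduced_map F k) (residue_vectors TYPE('p) k))"

end

theory Submission
  imports Defs
begin

text \<open>
  Choose \<open>k\<close> large and let \<open>H\<close> be the iterate of \<open>F\<close> of exponent \<open>p ^ (n (k + 1))\<close>, the length of the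
  cycle modulo \<open>p ^ (k + 1)\<close>, so that \<open>H\<close> is the identity modulo \<open>p ^ (k + 1)\<close>. By the chain rule \<open>H\<close>
  has at \<open>0\<close> one derivative \<open>A\<close> modulo \<open>p\<close> serving all scales \<open>p ^ K\<close>. At the scale \<open>p ^ k\<close> the
  triviality of \<open>H\<close> forces \<open>A\<close> to be the identity modulo \<open>p\<close>; hence at the scale \<open>p ^ (k + 1)\<close> the map
  \<open>H\<close> translates the fibre over \<open>0\<close>, and its \<open>p\<close>-th iterate fixes \<open>0\<close> modulo \<open>p ^ (k + 2)\<close>. The
  cycle modulo \<open>p ^ (k + 2)\<close> therefore has length \<open>p ^ (n (k + 2)) \<le> p ^ (n (k + 1) + 1)\<close>.
\<close>

section \<open>Scalars, residues and divisibility by powers of \<open>p\<close>\<close>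

lemma smult_vector_matrix_mult:
  fixes k :: "'a::comm_semiring_1" and A :: "'a ^ 'm ^ 'n"
  shows "(k *s x) v* A = k *s (x v* A)"
  by (simp add: vec_eq_iff vector_matrix_mult_def sum_distrib_left mult.assoc)

text \<open>A vanishing residue gives a quotient digit by digit: its level \<open>k\<close> is level
  \<open>k + s\<close> of \<open>x\<close> divided by \<open>p ^ s\<close>, the shift making up for
  the \<open>s\<close> digits that the division removes.\<close>

lemma padic_residue_eq_0_iff_dvd:
  fixes x :: "'p::prime_card padic_int"
  shows "padic_residue x s = 0 \<longleftrightarrow> of_nat CARD('p) ^ s dvd x"
proof
  let ?p = "int CARD('p)"
  note p = card_gt_0[where 'p='p]
  assume x: "padic_residue x s = 0"
  have range: "0 \<le> padic_residue x k" "padic_residue x k < ?p ^ k" for k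
    using padic_residue[of x] by auto
  have dvd: "?p ^ s dvd padic_residue x (k + s)" for k
    using padic_residue_mod[of s "k + s" x] x by (simp add: dvd_eq_mod_eq_0)
  define y where "y = (\<lambda>k. padic_residue x (k + s) div ?p ^ s)"
  have y: "padic_residue x (k + s) = ?p ^ s * y k" for k
    using dvd[of k] by (simp add: y_def)
  have y_mem: "y k \<in> {0..<?p ^ k} \<and> y (Suc k) mod ?p ^ k = y k" for k
  proof -
    have "?p ^ s * y k < ?p ^ s * ?p ^ k" "0 \<le> ?p ^ s * y k"
      using range[of "k + s"] y[of k] by (simp_all add: power_add mult.commute)
    moreover have "?p ^ s * y (Suc k) mod (?p ^ s * ?p ^ k) = ?p ^ s * y k"
      using padic_residue_mod[of "k + s" "Suc k + s" x] y[of k] y[of "Suc k"]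
      by (simp add: power_add mult.commute)
    then have "?p ^ s * (y (Suc k) mod ?p ^ k) = ?p ^ s * y k"
      by (simp only: mult_mod_right)
    ultimately show ?thesis
      using p zero_less_power[OF p, of s] by (simp add: zero_le_mult_iff)
  qed
  define z :: "'p padic_int" where "z = Abs_padic_int y"
  have rep: "padic_residue z = y"
    unfolding z_def using y_mem by (intro Abs_padic_int_inverse) auto
  have "x = of_int (?p ^ s) * z"
  proof (rule padic_residue_inject[THEN iffD1], rule ext)
    fix k
    have "padic_residue x k = padic_residue x (k + s) mod ?p ^ k"
      by (simp add: padic_residue_mod)
    also have "\<dots> = padic_residue (of_int (?p ^ s) * z) k"
      by (simp add: times_padic_int.rep_eq padic_residue_of_int rep y mod_simps del: of_int_power)
    finally show "padic_residue x k = padic_residue (of_int (?p ^ s) * z) k" .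
  qed
  then show "of_nat CARD('p) ^ s dvd x" by simp
next
  assume "of_nat CARD('p) ^ s dvd x"
  then obtain y where "x = of_int (int CARD('p) ^ s) * y" by (auto simp: dvd_def)
  then show "padic_residue x s = 0"
    by (simp add: times_padic_int.rep_eq padic_residue_of_int del: of_int_power)
qed

lemma padic_residue_cong_iff_dvd:
  fixes x y :: "'p::prime_card padic_int"
  shows "padic_residue x s = padic_residue y s \<longleftrightarrow> of_nat CARD('p) ^ s dvd x - y"
proof -
  have "padic_residue x s = padic_residue y s \<longleftrightarrow> padic_residue (x - y) s = 0"
    using mod_eq_dvd_iff[of "padic_residue x s" "int CARD('p) ^ s" "padic_residue y s"]
    by (simp add: padic_residue_mod minus_padic_int.rep_eq dvd_eq_mod_eq_0)
  then show ?thesis by (simp add: padic_residue_eq_0_iff_dvd)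
qed

lemma vec_scalar_multiple_iff:
  fixes u :: "'a::comm_ring_1 ^ 'n"
  shows "(\<exists>c. u = q *s c) \<longleftrightarrow> (\<forall>i. q dvd u $ i)"
proof
  assume "\<forall>i. q dvd u $ i"
  then have "\<forall>i. \<exists>c. u $ i = q * c" by (simp add: dvd_def)
  then obtain c where "\<forall>i. u $ i = q * c i" by metis
  then show "\<exists>c. u = q *s c" by (intro exI[of _ "\<chi> i. c i"]) (simp add: vec_eq_iff)
qed auto

definition vec_residue :: "nat \<Rightarrow> 'p::prime_card padic_int ^ 'n \<Rightarrow> int ^ 'n" where
  "vec_residue k u = (\<chi> i. padic_residue (u $ i) k)"

text \<open>Lets congruences be carried as equations with an explicit integral error vector
  \<open>c\<close>, so that later steps are plain algebra.\<close>

lemma vec_residue_eq_iff: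
  fixes u v :: "'p::prime_card padic_int ^ 'n"
  shows "vec_residue k u = vec_residue k v \<longleftrightarrow> (\<exists>c. u = v + of_nat CARD('p) ^ k *s c)"
proof -
  have "vec_residue k u = vec_residue k v \<longleftrightarrow> (\<exists>c. u - v = of_nat CARD('p) ^ k *s c)"
    unfolding vec_scalar_multiple_iff
    by (simp add: vec_residue_def vec_eq_iff padic_residue_cong_iff_dvd)
  then show ?thesis by (simp add: algebra_simps)
qed

lemma vec_residue_mem: "vec_residue k (u :: 'p::prime_card padic_int ^ 'n) \<in> residue_vectors TYPE('p) k"
  using padic_residue by (auto simp: vec_residue_def residue_vectors_def)

lemma vec_residue_of_int:
  assumes "x \<in> residue_vectors TYPE('p::prime_card) k"
  shows "vec_residue k ((\<chi> j. of_int (x $ j)) :: 'p padic_int ^ 'n) = x"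
  using assms by (simp add: vec_residue_def residue_vectors_def padic_residue_of_int vec_eq_iff)

lemma card_residue_vectors:
  "card (residue_vectors TYPE('p::prime_card) k :: (int ^ 'n) set) = CARD('p) ^ (k * CARD('n))"
proof -
  have "bij_betw vec_nth (residue_vectors TYPE('p) k :: (int ^ 'n) set)
      (UNIV \<rightarrow>\<^sub>E {0..<int CARD('p) ^ k})"
    by (rule bij_betwI[of _ _ _ vec_lambda])
      (auto simp: residue_vectors_def PiE_def Pi_def)
  then have "card (residue_vectors TYPE('p) k :: (int ^ 'n) set) =
      card ((UNIV :: 'n set) \<rightarrow>\<^sub>E {0..<int CARD('p) ^ k})"
    by (rule bij_betw_same_card)
  also have "\<dots> = (CARD('p) ^ k) ^ CARD('n)"
    by (simp add: card_PiE nat_power_eq)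
  finally show ?thesis by (simp add: power_mult)
qed

section \<open>Return times on a single cycle\<close>

lemma cyclic_on_funpow_card:
  assumes "cyclic_on f S" "x \<in> S"
  shows "(f ^^ card S) x = x"
proof -
  have S: "S = orbit f x" using assms by (simp add: orbit_cyclic_eq3)
  with assms have x: "x \<in> orbit f x" by simp
  have "card S = funpow_dist1 f x x"
    using orbit_conv_funpow_dist1[OF x] inj_on_funpow_dist1[OF x] S by (simp add: card_image)
  then show ?thesis using funpow_dist1_prop[OF x] by simp
qed

text \<open>The first \<open>m\<close> iterates of \<open>x\<close> already exhaust its orbit, which
  is all of \<open>S\<close>; \<open>m\<close> may be any positive return time.\<close>

lemma cyclic_on_card_le:
  assumes "cyclic_on f S" "x \<in> S" "(f ^^ m) x = x" "0 < m"
  shows "card S \<le> m"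
proof -
  have "S = (\<lambda>i. (f ^^ i) x) ` {..<m}"
    using orbit_altdef_bounded[OF assms(3,4)] assms(1,2) by (auto simp: orbit_cyclic_eq3)
  then show ?thesis using card_image_le[of "{..<m}"] by simp
qed

section \<open>Integral first-order expansions, their iterates and reductions\<close>

lemma padic_vnorm_le_iff:
  fixes u :: "'p::prime_card padic ^ 'n"
  shows "padic_vnorm u \<le> r \<longleftrightarrow> (\<forall>i. padic_norm (u $ i) \<le> r)"
  by (simp add: padic_vnorm_def)

lemma padic_vnorm_to_padic_vec_le_iff:
  fixes u :: "'p::prime_card padic_int ^ 'n"
  shows "padic_vnorm (to_padic_vec u) \<le> real CARD('p) powi (- int k) \<longleftrightarrow>
    (\<exists>c. u = of_nat CARD('p) ^ k *s c)"
  by (simp add: padic_vnorm_le_iff to_padic_vec_def padic_norm_to_fract padic_int_norm_le_iff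
      padic_residue_eq_0_iff_dvd vec_scalar_multiple_iff del: power_int_minus)

text \<open>Since the entries are integral, the derivative pulls back along \<open>to_fract\<close>,
  and a vector of norm at most \<open>p ^ (-K)\<close> is \<open>p ^ K\<close> times an integral
  one. This removes norms and fractions from the argument.\<close>

lemma is_derivative_mod_p_integralD:
  fixes F :: "'p::prime_card padic_int ^ 'n \<Rightarrow> 'p padic_int ^ 'n"
  assumes "is_derivative_mod_p F F'" "\<And>u i j. F' u $ i $ j \<in> range to_fract"
  obtains N D where "\<And>K u h. N \<le> K \<Longrightarrow> \<exists>c. F (u + of_nat CARD('p) ^ K *s h) =
      F u + of_nat CARD('p) ^ K *s (h v* D u) + of_nat CARD('p) ^ Suc K *s c"
proof -
  have "\<exists>d. F' u $ i $ j = to_fract d" for u i j using assms(2)[of u i j] by blast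
  then obtain d where d: "F' u $ i $ j = to_fract (d u i j)" for u i j by metis
  define D where "D = (\<lambda>u. \<chi> i j. d u i j)"
  have D: "to_padic_vec h v* F' u = to_padic_vec (h v* D u)" for u h
    by (simp add: vec_eq_iff vector_matrix_mult_def to_padic_vec_def D_def d to_fract_sum to_fract_mult)
  have diff: "to_padic_vec a - to_padic_vec b = to_padic_vec (a - b)"
    and add: "to_padic_vec a + to_padic_vec b = to_padic_vec (a + b)"
    for a b :: "'p padic_int ^ 'n"
    by (simp_all add: to_padic_vec_def vec_eq_iff to_fract_diff to_fract_add)
  obtain N where N: "\<And>K u h. N \<le> K \<Longrightarrow>
      padic_vnorm (to_padic_vec h) \<le> real CARD('p) powi (- int K) \<Longrightarrow>
      padic_vnorm (to_padic_vec (F (u + h) - (F u + h v* D u))) \<le> real CARD('p) powi (- int (Suc K))"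
    using assms(1) unfolding is_derivative_mod_p_def padic_cong_def
    by (auto simp only: D diff add plus_1_eq_Suc)
  show ?thesis
  proof (rule that[of N D])
    fix K and u h :: "'p padic_int ^ 'n"
    assume K: "N \<le> K"
    let ?h = "of_nat CARD('p) ^ K *s h"
    have "padic_vnorm (to_padic_vec ?h) \<le> real CARD('p) powi (- int K)"
      unfolding padic_vnorm_to_padic_vec_le_iff by blast
    then obtain c where "F (u + ?h) - (F u + ?h v* D u) = of_nat CARD('p) ^ Suc K *s c"
      using N[OF K, of ?h u] unfolding padic_vnorm_to_padic_vec_le_iff by blast
    then have "F (u + ?h) = F u + ?h v* D u + of_nat CARD('p) ^ Suc K *s c"
      by (simp add: algebra_simps)
    then show "\<exists>c. F (u + ?h) = F u + of_nat CARD('p) ^ K *s (h v* D u) + of_nat CARD('p) ^ Suc K *s c"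
      by (auto simp: smult_vector_matrix_mult)
  qed
qed

text \<open>The chain rule: \<open>A\<close> is the product of the matrices \<open>D\<close> along
  the orbit of \<open>u\<close>. Since \<open>D\<close> does not depend on \<open>K\<close>, one
  \<open>A\<close> serves all scales, hence the quantifier order.\<close>

lemma funpow_expansion:
  fixes F :: "'a::comm_ring_1 ^ 'n \<Rightarrow> 'a ^ 'n"
  assumes D: "\<And>K u h. N \<le> K \<Longrightarrow> \<exists>c. F (u + q ^ K *s h) = F u + q ^ K *s (h v* D u) + q ^ Suc K *s c"
  shows "\<exists>A. \<forall>K\<ge>N. \<forall>h. \<exists>c. (F ^^ m) (u + q ^ K *s h) =
      (F ^^ m) u + q ^ K *s (h v* A) + q ^ Suc K *s c"
proof (induction m)
  case 0
  show ?case by (intro exI[of _ "mat 1"] allI impI exI[of _ 0]) simp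
next
  case (Suc m)
  then obtain A where A: "\<And>K h. N \<le> K \<Longrightarrow> \<exists>c. (F ^^ m) (u + q ^ K *s h) =
      (F ^^ m) u + q ^ K *s (h v* A) + q ^ Suc K *s c" by blast
  let ?B = "D ((F ^^ m) u)"
  show ?case
  proof (intro exI[of _ "A ** ?B"] allI impI)
    fix K h
    assume K: "N \<le> K"
    obtain c where c: "(F ^^ m) (u + q ^ K *s h) =
        (F ^^ m) u + q ^ K *s (h v* A) + q ^ Suc K *s c" using A[OF K] by blast
    \<comment> \<open>The error is absorbed into the displacement, which remains
      \<open>q ^ K\<close> times an integral vector, so the expansion of \<open>F\<close> applies at
      the same scale.\<close>
    also have "\<dots> = (F ^^ m) u + q ^ K *s (h v* A + q *s c)"
      by (simp add: vector_add_ldistrib vector_smult_assoc mult.commute add.assoc)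
    finally obtain c' where "(F ^^ Suc m) (u + q ^ K *s h) = (F ^^ Suc m) u +
        q ^ K *s ((h v* A + q *s c) v* ?B) + q ^ Suc K *s c'"
      using D[OF K, of "(F ^^ m) u" "h v* A + q *s c"] by auto
    also have "\<dots> = (F ^^ Suc m) u + q ^ K *s (h v* (A ** ?B)) + q ^ Suc K *s (c v* ?B + c')"
      by (simp add: vector_matrix_left_distrib smult_vector_matrix_mult vector_matrix_mul_assoc
          vector_add_ldistrib vector_smult_assoc mult.commute add.assoc)
    finally show "\<exists>c. (F ^^ Suc m) (u + q ^ K *s h) =
        (F ^^ Suc m) u + q ^ K *s (h v* (A ** ?B)) + q ^ Suc K *s c" by blast
  qed
qed

text \<open>\<open>reduced_map\<close> evaluates \<open>F\<close> at integer representatives; the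
  assumption makes the residue of the value independent of the representative.\<close>

lemma reduced_map_vec_residue:
  fixes F :: "'p::prime_card padic_int ^ 'n \<Rightarrow> 'p padic_int ^ 'n"
  assumes "\<And>u h. \<exists>c. F (u + of_nat CARD('p) ^ k *s h) = F u + of_nat CARD('p) ^ k *s c"
  shows "reduced_map F k (vec_residue k u) = vec_residue k (F u)"
proof -
  define v :: "'p padic_int ^ 'n" where "v = (\<chi> j. of_int (vec_residue k u $ j))"
  have "vec_residue k v = vec_residue k u"
    unfolding v_def by (rule vec_residue_of_int[OF vec_residue_mem])
  then obtain h where "v = u + of_nat CARD('p) ^ k *s h" unfolding vec_residue_eq_iff by blast
  then have "vec_residue k (F v) = vec_residue k (F u)"
    using assms[of u h] by (simp add: vec_residue_eq_iff)
  then show ?thesis by (simp add: reduced_map_def vec_residue_def v_def)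
qed

lemma funpow_reduced_map_vec_residue:
  fixes F :: "'p::prime_card padic_int ^ 'n \<Rightarrow> 'p padic_int ^ 'n"
  assumes "\<And>u h. \<exists>c. F (u + of_nat CARD('p) ^ k *s h) = F u + of_nat CARD('p) ^ k *s c"
  shows "(reduced_map F k ^^ m) (vec_residue k u) = vec_residue k ((F ^^ m) u)"
  by (induction m) (simp_all add: reduced_map_vec_residue assms)

text \<open>Modulo \<open>a * q\<close> the map \<open>H\<close> acts on the coset of
  \<open>u\<close> modulo \<open>a\<close> as translation by \<open>a *s b\<close>, and translations
  add up under iteration.\<close>

lemma funpow_translation_mod:
  fixes H :: "'a::comm_ring_1 ^ 'n \<Rightarrow> 'a ^ 'n"
  assumes H: "\<And>h. \<exists>c. H (u + a *s h) = H u + a *s h + (a * q) *s c"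
    and u: "H u = u + a *s b"
  shows "\<exists>c. (H ^^ j) u = u + a *s (of_nat j *s b) + (a * q) *s c"
proof (induction j)
  case 0
  show ?case by (rule exI[of _ 0]) simp
next
  case (Suc j)
  then obtain c where "(H ^^ j) u = u + a *s (of_nat j *s b) + (a * q) *s c" by blast
  also have "\<dots> = u + a *s (of_nat j *s b + q *s c)"
    by (simp add: vector_add_ldistrib vector_smult_assoc add.assoc)
  finally obtain c' where "(H ^^ Suc j) u = H u + a *s (of_nat j *s b + q *s c) + (a * q) *s c'"
    using H[of "of_nat j *s b + q *s c"] by auto
  also have "\<dots> = u + a *s (of_nat (Suc j) *s b) + (a * q) *s (c + c')"
    by (simp add: u vec_eq_iff algebra_simps)
  finally show ?case by blast
qed

theorem theorem3p11:
  fixes F :: "'p::prime_card padic_int ^ 'n \<Rightarrow> 'p padic_int ^ 'n"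
  assumes "uniformly_differentiable_mod_p F"
    and "integer_valued_derivatives_mod_p F"
    and "asymptotically_ergodic F"
  shows "CARD('n) = 1"
proof -
  let ?q = "of_nat CARD('p) :: 'p padic_int"
  have p: "1 < CARD('p)" using prime_card[where 'a='p] prime_gt_1_nat by blast
  \<comment> \<open>The residue is taken modulo \<open>p ^ 2\<close>, since \<open>p\<close>
    vanishes modulo \<open>p\<close>.\<close>
  then have q: "?q \<noteq> 0"
    using padic_residue_of_int[where 'p='p and a="int CARD('p)" and k=2]
    by (auto simp: zero_padic_int.rep_eq power2_eq_square)
  obtain F' where "is_derivative_mod_p F F'" "\<And>u i j. F' u $ i $ j \<in> range to_fract"
    using assms(2) unfolding integer_valued_derivatives_mod_p_def by blast
  then obtain N D where D: "\<And>K u h. N \<le> K \<Longrightarrow>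
      \<exists>c. F (u + ?q ^ K *s h) = F u + ?q ^ K *s (h v* D u) + ?q ^ Suc K *s c"
    by (rule is_derivative_mod_p_integralD) blast
  \<comment> \<open>Integrality of \<open>D u\<close> enters: the linear term is itself divisible by
    \<open>?q ^ K\<close>.\<close>
  have compat: "\<exists>c. F (u + ?q ^ K *s h) = F u + ?q ^ K *s c" if "N \<le> K" for K u h
  proof -
    obtain c where "F (u + ?q ^ K *s h) = F u + ?q ^ K *s (h v* D u) + ?q ^ Suc K *s c"
      using D[OF \<open>N \<le> K\<close>] by blast
    also have "\<dots> = F u + ?q ^ K *s (h v* D u + ?q *s c)"
      by (simp add: vector_add_ldistrib vector_smult_assoc mult.commute add.assoc)
    finally show ?thesis by blast
  qed
  note residue = funpow_reduced_map_vec_residue[OF compat]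
  obtain M where M: "\<And>k. M \<le> k \<Longrightarrow> cyclic_on (reduced_map F k) (residue_vectors TYPE('p) k)"
    using assms(3) unfolding asymptotically_ergodic_def eventually_sequentially by blast
  \<comment> \<open>Expansions are needed at the scales \<open>k\<close> and \<open>Suc k\<close>,
    single cycles at the levels \<open>Suc k\<close> and \<open>Suc (Suc k)\<close>.\<close>
  define k where "k = max M N"
  have k: "N \<le> k" "N \<le> Suc k" "N \<le> Suc (Suc k)" "M \<le> Suc k" "M \<le> Suc (Suc k)"
    by (simp_all add: k_def)
  define m where "m = CARD('p) ^ (Suc k * CARD('n))"
  define H where "H = F ^^ m"
  have H: "\<exists>c. H u = u + ?q ^ Suc k *s c" for u
    using cyclic_on_funpow_card[OF M[OF k(4)] vec_residue_mem, of u]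
    unfolding residue[OF k(2)] card_residue_vectors m_def[symmetric] H_def[symmetric]
      vec_residue_eq_iff .
  obtain A where A: "\<And>K h. N \<le> K \<Longrightarrow>
      \<exists>c. H (0 + ?q ^ K *s h) = H 0 + ?q ^ K *s (h v* A) + ?q ^ Suc K *s c"
    using funpow_expansion[OF D, where u=0 and m=m] unfolding H_def by blast
  have hA: "\<exists>c. h v* A = h + ?q *s c" for h
  proof -
    obtain b where b: "H 0 = 0 + ?q ^ Suc k *s b" using H by blast
    obtain c where c: "H (0 + ?q ^ k *s h) = H 0 + ?q ^ k *s (h v* A) + ?q ^ Suc k *s c"
      using A[OF k(1)] by blast
    obtain d where d: "H (0 + ?q ^ k *s h) = 0 + ?q ^ k *s h + ?q ^ Suc k *s d" using H by blast
    \<comment> \<open>The coefficients \<open>b\<close>, \<open>c\<close>, \<open>d\<close> all sit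
      at scale \<open>Suc k\<close>, so dividing by \<open>?q ^ k\<close> leaves
      \<open>h v* A\<close> known modulo \<open>?q\<close> only.\<close>
    have "?q ^ k *s (h v* A) = ?q ^ k *s (h + ?q *s (d - b - c))"
      using b c d by (simp add: vec_eq_iff algebra_simps)
    then have "h v* A = h + ?q *s (d - b - c)" using q by (simp add: vec_eq_iff)
    then show ?thesis by blast
  qed
  \<comment> \<open>The matrix found at scale \<open>k\<close> is reused at scale
    \<open>Suc k\<close>, where the expansion is finer than the triviality of
    \<open>H\<close>.\<close>
  have trans: "\<exists>c. H (0 + ?q ^ Suc k *s h) = H 0 + ?q ^ Suc k *s h + (?q ^ Suc k * ?q) *s c" for h
  proof -
    obtain c where c: "H (0 + ?q ^ Suc k *s h) = H 0 + ?q ^ Suc k *s (h v* A) + ?q ^ Suc (Suc k) *s c"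
      using A[OF k(2)] by blast
    obtain d where "h v* A = h + ?q *s d" using hA by blast
    with c have "H (0 + ?q ^ Suc k *s h) = H 0 + ?q ^ Suc k *s h + (?q ^ Suc k * ?q) *s (d + c)"
      by (simp add: vec_eq_iff algebra_simps)
    then show ?thesis by blast
  qed
  obtain b where b: "H 0 = 0 + ?q ^ Suc k *s b" using H by blast
  \<comment> \<open>With \<open>j = CARD('p)\<close> the accumulated translation is
    \<open>?q *s b\<close>, which gains one more factor \<open>?q\<close>.\<close>
  obtain c where "(H ^^ CARD('p)) 0 = 0 + ?q ^ Suc k *s (?q *s b) + (?q ^ Suc k * ?q) *s c"
    using funpow_translation_mod[OF trans b] by blast
  also have "\<dots> = 0 + ?q ^ Suc (Suc k) *s (b + c)"
    by (simp add: vec_eq_iff algebra_simps)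
  finally have "vec_residue (Suc (Suc k)) ((H ^^ CARD('p)) 0) =
      vec_residue (Suc (Suc k)) (0 :: 'p padic_int ^ 'n)"
    unfolding vec_residue_eq_iff by blast
  then have "(reduced_map F (Suc (Suc k)) ^^ (m * CARD('p)))
      (vec_residue (Suc (Suc k)) (0 :: 'p padic_int ^ 'n)) =
      vec_residue (Suc (Suc k)) (0 :: 'p padic_int ^ 'n)"
    unfolding residue[OF k(3)] H_def funpow_mult .
  then have "card (residue_vectors TYPE('p) (Suc (Suc k)) :: (int ^ 'n) set) \<le> m * CARD('p)"
    using p by (intro cyclic_on_card_le[OF M[OF k(5)] vec_residue_mem]) (auto simp: m_def)
  then have "CARD('p) ^ (Suc (Suc k) * CARD('n)) \<le> CARD('p) ^ Suc (Suc k * CARD('n))"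
    by (simp add: card_residue_vectors m_def mult.commute)
  \<comment> \<open>Passing to the next level multiplies the cycle length by \<open>p ^ n\<close>,
    while the return time found grows only by the factor \<open>p\<close>.\<close>
  then have "Suc (Suc k) * CARD('n) \<le> Suc (Suc k * CARD('n))"
    using p by (rule power_le_imp_le_exp[rotated])
  then have "CARD('n) \<le> 1" by simp
  moreover have "0 < CARD('n)" by simp
  ultimately show ?thesis by linarith
qed

end
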